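(* Let $Y$ be a random variable whose moment generating function $E[e^{tY}]$ exists for $|t|<\delta$ for some $\delta>0$. Let $(Y_j)_{j\ge1}$ be mutually independent copies of $Y$, $S_0=0$, $S_k=Y_1+\cdots+Y_k$. Define ${n\brace k}_Y=\frac{1}{k!}\sum_{l=0}^{k}\binom{k}{l}(-1)^{k-l}E[S_l^n]$ for $0\le k\le n$, and the probabilistic Bell numbers $\phi^Y_n=\sum_{k=0}^{n}{n\brace k}_Y$. Then for all $n,l\ge0$, $$\phi^Y_{l+n}=\sum_{k=0}^{n}\sum_{m=0}^{l}\binom{l}{m}\frac{1}{k!}\sum_{l_1+\cdots+l_k=n}\binom{n}{l_1,\dots,l_k}E\Big[S_k^{l-m}\prod_{i=1}^{k}Y_i^{l_i}\Big]\phi^Y_m,$$ where the inner sum runs over $k$-tuples of positive integers $(l_1,\dots,l_k)$ with $l_1+\cdots+l_k=n$.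
   Context: $E$ denotes expectation. For $k=0$ the inner sum over compositions is the empty-tuple sum, equal to $1$ if $n=0$ and $0$ otherwise (empty product equal to $1$). Equivalently, $\sum_{n\ge0}\phi^Y_n t^n/n!=e^{E[e^{Yt}]-1}$. *)

theory Defs
  imports "HOL-Probability.Probability"
begin

text \<open>
  Throughout, \<open>M\<close> is the underlying probability space and \<open>X 1, X 2, \<dots>\<close> are the independent copies
  of the given random variable; the value \<open>X 0\<close> is never used.
\<close>

definition partial_sum :: "(nat \<Rightarrow> 'a \<Rightarrow> real) \<Rightarrow> nat \<Rightarrow> 'a \<Rightarrow> real" where
  "partial_sum X k \<omega> = (\<Sum>j=1..k. X j \<omega>)"

definition prob_stirling :: "'a measure \<Rightarrow> (nat \<Rightarrow> 'a \<Rightarrow> real) \<Rightarrow> nat \<Rightarrow> nat \<Rightarrow> real" where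
  "prob_stirling M X n k =
     1 / fact k * (\<Sum>l=0..k. real (k choose l) * (-1) ^ (k - l) *
       prob_space.expectation M (\<lambda>\<omega>. partial_sum X l \<omega> ^ n))"

definition prob_bell :: "'a measure \<Rightarrow> (nat \<Rightarrow> 'a \<Rightarrow> real) \<Rightarrow> nat \<Rightarrow> real" where
  "prob_bell M X n = (\<Sum>k=0..n. prob_stirling M X n k)"

text \<open>
  A \<open>k\<close>-tuple is an extensional function on \<open>{1..k}\<close>, so that distinct elements of the set are
  distinct tuples. For \<open>k = 0\<close> there is exactly one such function, the empty tuple, with sum \<open>0\<close>.
\<close>

definition compositions :: "nat \<Rightarrow> nat \<Rightarrow> (nat \<Rightarrow> nat) set" where
  "compositions n k = {ls \<in> {1..k} \<rightarrow>\<^sub>E {1..}. (\<Sum>i=1..k. ls i) = n}"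

lemma finite_compositions: "finite (compositions n k)"
proof (rule finite_subset)
  show "compositions n k \<subseteq> {1..k} \<rightarrow>\<^sub>E {..n}"
  proof
    fix ls assume ls: "ls \<in> compositions n k"
    have "ls i \<le> n" if "i \<in> {1..k}" for i
    proof -
      have "ls i \<le> (\<Sum>i=1..k. ls i)"
        using that by (intro member_le_sum) auto
      then show ?thesis using ls by (simp add: compositions_def)
    qed
    then show "ls \<in> {1..k} \<rightarrow>\<^sub>E {..n}"
      using ls by (auto simp: compositions_def PiE_iff)
  qed
  show "finite ({1..k} \<rightarrow>\<^sub>E {..n})"
    by (intro finite_PiE) auto
qed

definition multinomial :: "nat \<Rightarrow> nat \<Rightarrow> (nat \<Rightarrow> nat) \<Rightarrow> real" where
  "multinomial n k ls = fact n / (\<Prod>i=1..k. fact (ls i))"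

end

(*
  Let b(x) = exp(f(x) - 1), where f(x) = E[exp(x Y)], be the exponential generating function of the
  probabilistic Bell numbers. Then b(x + y) = b(x) exp(f(x + y) - f(x)), and by independence
  (f(x + y) - f(x))^k = E[exp(x S_k) * prod_i (exp(y Y_i) - 1)], whose coefficients are the inner
  sums over compositions of the theorem. Everything takes place in formal power series; the
  hypothesis on the moment generating function only serves to make all moments finite.
*)
theory Submission
  imports Defs
begin

unbundle no vec_syntax
unbundle fps_syntax

section \<open>Exponential generating functions\<close>

definition egf :: "(nat \<Rightarrow> 'a) \<Rightarrow> 'a::field_char_0 fps" where
  "egf a = Abs_fps (\<lambda>n. a n / fact n)"

lemma egf_nth [simp]: "egf a $ n = a n / fact n"
  by (simp add: egf_def)

lemma fps_deriv_egf [simp]: "fps_deriv (egf a) = egf (\<lambda>n. a (Suc n))"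
  by (rule fps_ext) (simp add: field_simps del: of_nat_Suc)

lemma fps_exp_sum: "finite A \<Longrightarrow> fps_exp (\<Sum>i\<in>A. f i) = (\<Prod>i\<in>A. fps_exp (f i :: 'a::field_char_0))"
  by (induction A rule: finite_induct) (simp_all add: fps_exp_add_mult)

lemma fps_const_prod: "fps_const (\<Prod>i\<in>A. f i) = (\<Prod>i\<in>A. fps_const (f i :: 'a::comm_ring_1))"
  by (induction A rule: infinite_finite_induct) (simp_all flip: fps_const_mult)

text \<open>The product formula for power series sums over multisets of size \<open>n\<close> on
  \<open>{1..k}\<close>, whose multiplicities are the exponents chosen in the \<open>k\<close>
  factors. A multiset missing some index contributes a factor \<open>G $ 0 = 0\<close>, so only
  tuples of positive integers survive.\<close>

lemma fps_power_nth_compositions: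
  fixes G :: "'a::comm_ring_1 fps"
  assumes "G $ 0 = 0"
  shows "(G ^ k) $ n = (\<Sum>ls\<in>compositions n k. \<Prod>i=1..k. G $ ls i)"
proof -
  \<comment> \<open>Outside \<open>{1..k}\<close> the function \<open>count X\<close> is 0, whereas
    a composition must be \<open>undefined\<close> there; hence the \<open>restrict\<close>.\<close>
  let ?to = "\<lambda>X. restrict (count X) {1..k}"
  let ?from = "\<lambda>ls. \<Sum>i=1..k. replicate_mset (ls i) i"
  let ?P = "{X \<in> multisets_of_size {1..k} n. \<forall>i\<in>{1..k}. count X i \<ge> 1}"
  have count_from: "count (?from ls) i = (if i \<in> {1..k} then ls i else 0)" for ls i
    by (simp add: count_sum)
  have from_to: "?from (?to X) = X" if "set_mset X \<subseteq> {1..k}" for X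
  proof (rule multiset_eqI)
    fix i show "count (?from (?to X)) i = count X i"
      using that by (simp only: count_from) (auto simp: count_eq_zero_iff)
  qed
  have to_from: "?to (?from ls) = ls" if "ls \<in> {1..k} \<rightarrow>\<^sub>E {1..}" for ls
  proof (rule ext)
    fix i show "?to (?from ls) i = ls i"
      using PiE_arb[OF that, of i] by (simp only: restrict_apply count_from) presburger
  qed
  have set_from: "set_mset (?from ls) \<subseteq> {1..k}" for ls
    by (auto simp: set_mset_sum)
  have size_from: "size (?from ls) = (\<Sum>i=1..k. ls i)" for ls
    by (simp add: size_multiset_sum)
  have "(G ^ k) $ n = (\<Prod>i\<in>{1..k}. G) $ n"
    by simp
  also have "\<dots> = (\<Sum>X\<in>multisets_of_size {1..k} n. \<Prod>i=1..k. G $ count X i)"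
    by (rule fps_prod_nth'[where f = "\<lambda>_. G", OF finite_atLeastAtMost])
  also have "\<dots> = (\<Sum>X\<in>?P. \<Prod>i=1..k. G $ count X i)"
  proof (rule sum.mono_neutral_right)
    show "\<forall>X\<in>multisets_of_size {1..k} n - ?P. (\<Prod>i=1..k. G $ count X i) = 0"
    proof
      fix X assume "X \<in> multisets_of_size {1..k} n - ?P"
      then obtain i where i: "i \<in> {1..k}" "\<not> count X i \<ge> 1"
        by blast
      then have "count X i = 0"
        by linarith
      then have "G $ count X i = 0"
        by (simp only: assms)
      then show "(\<Prod>i=1..k. G $ count X i) = 0"
        using i by (intro prod_zero bexI[of _ i]) auto
    qed
  qed auto
  also have "\<dots> = (\<Sum>ls\<in>compositions n k. \<Prod>i=1..k. G $ ls i)"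
  proof (rule sum.reindex_bij_witness[where i = ?from and j = ?to])
    fix X assume "X \<in> ?P"
    then have sub: "set_mset X \<subseteq> {1..k}" and sz: "size X = n"
      and pos: "\<And>i. i \<in> {1..k} \<Longrightarrow> count X i \<ge> 1"
      by (auto simp: multisets_of_size_def)
    show "?from (?to X) = X" by (rule from_to[OF sub])
    have "(\<Sum>i=1..k. ?to X i) = n"
      by (simp only: size_from[symmetric] from_to[OF sub] sz)
    then show "?to X \<in> compositions n k"
      using pos by (simp add: compositions_def PiE_iff)
    show "(\<Prod>i=1..k. G $ ?to X i) = (\<Prod>i=1..k. G $ count X i)"
      by (rule prod.cong) auto
  next
    fix ls assume "ls \<in> compositions n k"
    then have ls: "ls \<in> {1..k} \<rightarrow>\<^sub>E {1..}" and sum: "(\<Sum>i=1..k. ls i) = n"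
      by (auto simp: compositions_def)
    show "?to (?from ls) = ls" by (rule to_from[OF ls])
    have "?from ls \<in> multisets_of_size {1..k} n"
      unfolding multisets_of_size_def using set_from[of ls] size_from[of ls] sum by blast
    moreover have "count (?from ls) i \<ge> 1" if "i \<in> {1..k}" for i
      using PiE_mem[OF ls that] that by (simp only: count_from if_True atLeast_iff)
    ultimately show "?from ls \<in> ?P" by blast
  qed
  finally show ?thesis .
qed

section \<open>The Faa di Bruno formula for exponentials\<close>

text \<open>A series over series is read as a series in y with coefficients in x. This is the
  derivative in x; \<open>fps_deriv\<close> on the outer series is the one in y.\<close>

definition inner_deriv :: "'a::comm_semiring_1 fps fps \<Rightarrow> 'a fps fps" where
  "inner_deriv H = Abs_fps (\<lambda>n. fps_deriv (H $ n))"

lemma inner_deriv_nth [simp]: "inner_deriv H $ n = fps_deriv (H $ n)"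
  by (simp add: inner_deriv_def)

lemma inner_deriv_mult: "inner_deriv (H * K) = inner_deriv H * K + H * inner_deriv K"
  by (rule fps_ext) (simp add: fps_mult_nth fps_deriv_sum sum.distrib add.commute)

lemma inner_deriv_power_Suc:
  "inner_deriv (H ^ Suc k) = of_nat (Suc k) * (H ^ k * inner_deriv H)"
proof (induction k)
  case (Suc k)
  have "inner_deriv (H ^ Suc (Suc k)) = inner_deriv H * H ^ Suc k + H * inner_deriv (H ^ Suc k)"
    by (subst power_Suc) (rule inner_deriv_mult)
  then show ?case by (simp only: Suc.IH) (simp add: algebra_simps)
qed simp

text \<open>
  With \<open>F j\<close> and \<open>B j\<close> the \<open>j\<close>-th derivatives of \<open>f\<close> and \<open>b\<close>, the series \<open>G\<close> over the ring of power series in \<open>x\<close> is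
  \<open>f(x + y) - f(x)\<close>, expanded in \<open>y\<close>, and \<open>b(x + y) = b(x) exp G\<close>. Since \<open>\<partial>\<^sub>y G = f'(x) + \<partial>\<^sub>x G\<close>,
  the \<open>y\<close>-coefficients of \<open>G\<^sup>k / k!\<close> satisfy a Stirling-type recurrence.
\<close>

lemma faa_di_bruno_exp:
  fixes F B :: "nat \<Rightarrow> 'a::field_char_0 fps"
  assumes F: "\<And>j. fps_deriv (F j) = F (Suc j)"
    and B: "\<And>j. fps_deriv (B j) = B (Suc j)"
    and B1: "B 1 = B 0 * F 1"
  defines "G \<equiv> Abs_fps (\<lambda>j. if j = 0 then 0 else fps_const (1 / fact j) * F j)"
  shows "B n = fps_const (fact n) * B 0 * (\<Sum>k=0..n. fps_const (1 / fact k) * (G ^ k) $ n)"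
proof -
  define C where "C k n = fps_const (1 / fact k) * (G ^ k) $ n" for k n
  have G0: "G $ 0 = 0" by (simp add: G_def)
  \<comment> \<open>The two derivatives agree except at y^0: there \<open>inner_deriv G\<close>
    vanishes because \<open>G $ 0 = 0\<close>, and the summand \<open>F 1\<close> supplies the
    missing coefficient.\<close>
  have dG: "fps_deriv G = fps_const (F 1) + inner_deriv G"
  proof (rule fps_ext)
    fix j
    have "of_nat (Suc j) * fps_const (1 / fact (Suc j)) = fps_const (1 / fact j :: 'a)"
      by (simp add: fps_of_nat[symmetric] field_simps del: of_nat_Suc)
    then have "fps_deriv G $ j = fps_const (1 / fact j) * F (Suc j)"
      by (simp add: G_def mult.assoc[symmetric] del: of_nat_Suc)
    then show "fps_deriv G $ j = (fps_const (F 1) + inner_deriv G) $ j"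
      by (cases j) (simp_all add: G_def F)
  qed
  \<comment> \<open>Compare coefficients of y^n on both sides of the y-derivative of
    \<open>G ^ Suc k\<close>, computed from \<open>dG\<close>, and divide by (k+1)!.\<close>
  have rec: "of_nat (Suc n) * C (Suc k) (Suc n) = F 1 * C k n + fps_deriv (C (Suc k) n)" for k n
  proof -
    have c: "fps_const (1 / fact (Suc k)) * of_nat (Suc k) = fps_const (1 / fact k :: 'a)"
      by (simp add: fps_of_nat[symmetric] field_simps del: of_nat_Suc)
    have "of_nat (Suc n) * (G ^ Suc k) $ Suc n = fps_deriv (G ^ Suc k) $ n"
      by (simp only: fps_deriv_nth Suc_eq_plus1)
    also have "fps_deriv (G ^ Suc k) = of_nat (Suc k) * (fps_const (F 1) * G ^ k) + inner_deriv (G ^ Suc k)"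
      by (simp only: fps_deriv_power' dG inner_deriv_power_Suc) (simp add: algebra_simps)
    also have "\<dots> $ n = of_nat (Suc k) * (F 1 * (G ^ k) $ n) + fps_deriv ((G ^ Suc k) $ n)"
      by (simp add: fps_of_nat[symmetric] del: of_nat_Suc power_Suc)
    finally have "of_nat (Suc n) * (fps_const (1 / fact (Suc k)) * (G ^ Suc k) $ Suc n) =
        (fps_const (1 / fact (Suc k)) * of_nat (Suc k)) * (F 1 * (G ^ k) $ n) +
        fps_const (1 / fact (Suc k)) * fps_deriv ((G ^ Suc k) $ n)"
      by (simp only: mult.left_commute[of "of_nat (Suc n)"]) (simp only: distrib_left mult.assoc)
    then show ?thesis unfolding c C_def
      by (simp add: mult.left_commute del: power_Suc of_nat_Suc fact_Suc)
  qed
  have "B n = fps_const (fact n) * B 0 * (\<Sum>k=0..n. C k n)"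
  proof (induction n)
    case 0
    then show ?case by (simp add: C_def)
  next
    case (Suc n)
    have C0: "C 0 (Suc n) = 0" "fps_deriv (C 0 n) = 0"
      by (simp_all add: C_def)
    \<comment> \<open>\<open>G ^ Suc n\<close> is divisible by y^(n+1). This lets the shifted sum,
      which reaches \<open>Suc n\<close>, be cut back to \<open>0..n\<close>.\<close>
    have Cn: "C (Suc n) n = 0"
      using G0 by (simp add: C_def startsby_zero_power_prefix del: power_Suc)
    have "of_nat (Suc n) * (\<Sum>k=0..Suc n. C k (Suc n)) = (\<Sum>k=0..n. of_nat (Suc n) * C (Suc k) (Suc n))"
      by (simp only: sum.atLeast0_atMost_Suc_shift C0 sum_distrib_left comp_def add_0_left)
    also have "\<dots> = F 1 * (\<Sum>k=0..n. C k n) + (\<Sum>k=0..n. fps_deriv (C (Suc k) n))"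
      by (simp only: rec sum.distrib sum_distrib_left)
    also have "(\<Sum>k=0..n. fps_deriv (C (Suc k) n)) = (\<Sum>k=0..Suc n. fps_deriv (C k n))"
      by (simp only: sum.atLeast0_atMost_Suc_shift C0) simp
    also have "\<dots> = fps_deriv (\<Sum>k=0..n. C k n)"
      by (simp add: Cn fps_deriv_sum)
    finally have R: "of_nat (Suc n) * (\<Sum>k=0..Suc n. C k (Suc n)) =
        F 1 * (\<Sum>k=0..n. C k n) + fps_deriv (\<Sum>k=0..n. C k n)" .
    have "B (Suc n) = fps_deriv (fps_const (fact n) * B 0 * (\<Sum>k=0..n. C k n))"
      using B[of n] Suc.IH by simp
    also have "\<dots> = fps_const (fact n) * B 0 * (F 1 * (\<Sum>k=0..n. C k n) + fps_deriv (\<Sum>k=0..n. C k n))"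
      using B[of 0] B1 by (simp add: algebra_simps)
    also have "\<dots> = fps_const (fact (Suc n)) * B 0 * (\<Sum>k=0..Suc n. C k (Suc n))"
    proof -
      have "fps_const (fact (Suc n)) = fps_const (fact n :: 'a) * of_nat (Suc n)"
        by (simp add: fps_of_nat[symmetric] mult.commute del: of_nat_Suc)
      then show ?thesis
        by (simp only: R[symmetric] mult_ac)
    qed
    finally show ?case .
  qed
  then show ?thesis unfolding C_def .
qed

section \<open>Moments of independent copies\<close>

context prob_space
begin

text \<open>A single term of the exponential series gives (s|y|)^n / n! \<le> exp(s|y|) \<le>
  exp(sy) + exp(-sy), so every power is dominated by two values of the integrand of the moment
  generating function.\<close>

lemma integrable_power_of_mgf:
  fixes Y :: "'a \<Rightarrow> real"
  assumes [measurable]: "Y \<in> borel_measurable M"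
    and "\<delta> > 0"
    and mgf: "\<And>t. \<bar>t\<bar> < \<delta> \<Longrightarrow> integrable M (\<lambda>\<omega>. exp (t * Y \<omega>))"
  shows "integrable M (\<lambda>\<omega>. Y \<omega> ^ n)"
proof -
  define s where "s = \<delta> / 2"
  have s: "s > 0" "\<bar>s\<bar> < \<delta>" "\<bar>- s\<bar> < \<delta>" using \<open>\<delta> > 0\<close> by (auto simp: s_def)
  show ?thesis
  proof (rule Bochner_Integration.integrable_bound)
    show "integrable M (\<lambda>\<omega>. fact n / s ^ n * (exp (s * Y \<omega>) + exp (- s * Y \<omega>)))"
      using mgf[OF s(2)] mgf[OF s(3)] by simp
    have "\<bar>y\<bar> ^ n \<le> fact n / s ^ n * (exp (s * y) + exp (- s * y))" for y
    proof -
      have "(s * \<bar>y\<bar>) ^ n / fact n \<le> exp (s * \<bar>y\<bar>)"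
        using sum_le_suminf[OF summable_exp, of "{n}" "s * \<bar>y\<bar>"] s(1)
        by (simp add: exp_def field_simps)
      also have "\<dots> \<le> exp (s * y) + exp (- s * y)"
        by (cases "y \<ge> 0") simp_all
      finally show ?thesis
        using s(1) by (simp add: field_simps)
    qed
    then have "norm (Y \<omega> ^ n) \<le> fact n / s ^ n * (exp (s * Y \<omega>) + exp (- s * Y \<omega>))" for \<omega>
      by (simp add: power_abs)
    then show "AE \<omega> in M. norm (Y \<omega> ^ n) \<le> norm (fact n / s ^ n * (exp (s * Y \<omega>) + exp (- s * Y \<omega>)))"
      by (intro AE_I2) (simp only: real_norm_def order_trans[OF _ abs_ge_self])
  qed simp
qed

text \<open>The power of the partial sum is expanded through exp(t S_k) = \<Prod> exp(t Y_i), and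
  independence factors the expectation of each monomial. The extra powers only shift moments:
  \<open>egf (\<lambda>q. a (q + ls i))\<close> is the series of E[Y^(ls i) exp(tY)], a derivative
  of \<open>egf a\<close>.\<close>

lemma expectation_partial_sum_power_mult_prod:
  fixes Ys :: "nat \<Rightarrow> 'a \<Rightarrow> real"
  assumes indep: "indep_vars (\<lambda>_. borel) Ys {1..}"
    and int: "\<And>j n. j \<ge> 1 \<Longrightarrow> integrable M (\<lambda>\<omega>. Ys j \<omega> ^ n)"
    and mom: "\<And>j n. j \<ge> 1 \<Longrightarrow> expectation (\<lambda>\<omega>. Ys j \<omega> ^ n) = a n"
  shows "expectation (\<lambda>\<omega>. partial_sum Ys k \<omega> ^ p * (\<Prod>i=1..k. Ys i \<omega> ^ ls i)) =
    fact p * (\<Prod>i=1..k. egf (\<lambda>q. a (q + ls i))) $ p"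
proof -
  let ?S = "multisets_of_size {1..k} p"
  have expand: "partial_sum Ys k \<omega> ^ p * (\<Prod>i=1..k. Ys i \<omega> ^ ls i) =
      fact p * (\<Sum>X\<in>?S. \<Prod>i=1..k. Ys i \<omega> ^ (count X i + ls i) / fact (count X i))" for \<omega>
  proof -
    have "partial_sum Ys k \<omega> ^ p = fact p * fps_exp (\<Sum>i=1..k. Ys i \<omega>) $ p"
      by (simp add: partial_sum_def)
    also have "\<dots> = fact p * (\<Sum>X\<in>?S. \<Prod>i=1..k. Ys i \<omega> ^ count X i / fact (count X i))"
      by (simp only: fps_exp_sum finite_atLeastAtMost fps_prod_nth' fps_exp_nth of_nat_fact)
    finally show ?thesis
      by (simp add: sum_distrib_right mult.assoc prod.distrib[symmetric] power_add)
  qed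
  have ind: "indep_vars (\<lambda>_. borel) (\<lambda>i \<omega>. Ys i \<omega> ^ (count X i + ls i) / fact (count X i)) {1..k}" for X
    by (rule indep_vars_compose2[where Y = "\<lambda>i y. y ^ (count X i + ls i) / fact (count X i)",
          OF indep_vars_subset[OF indep]]) auto
  have int': "integrable M (\<lambda>\<omega>. Ys i \<omega> ^ (count X i + ls i) / fact (count X i))" if "i \<in> {1..k}" for X i
    using int that by simp
  have int_prod: "integrable M (\<lambda>\<omega>. \<Prod>i=1..k. Ys i \<omega> ^ (count X i + ls i) / fact (count X i))" for X
    by (rule indep_vars_integrable[OF _ ind int']) auto
  have exp_prod: "expectation (\<lambda>\<omega>. \<Prod>i=1..k. Ys i \<omega> ^ (count X i + ls i) / fact (count X i)) =
      (\<Prod>i=1..k. a (count X i + ls i) / fact (count X i))" for X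
    by (subst indep_vars_lebesgue_integral[OF _ ind int']) (auto simp: mom intro!: prod.cong)
  have "expectation (\<lambda>\<omega>. partial_sum Ys k \<omega> ^ p * (\<Prod>i=1..k. Ys i \<omega> ^ ls i)) =
      fact p * (\<Sum>X\<in>?S. expectation (\<lambda>\<omega>. \<Prod>i=1..k. Ys i \<omega> ^ (count X i + ls i) / fact (count X i)))"
    unfolding expand
    by (simp add: Bochner_Integration.integral_sum int_prod del: One_nat_def)
  also have "\<dots> = fact p * (\<Sum>X\<in>?S. \<Prod>i=1..k. a (count X i + ls i) / fact (count X i))"
    by (simp only: exp_prod)
  also have "\<dots> = fact p * (\<Prod>i=1..k. egf (\<lambda>q. a (q + ls i))) $ p"
    by (simp add: fps_prod_nth')
  finally show ?thesis .
qed

text \<open>Since E[S_l^m] is m! times a coefficient of \<open>egf a ^ l\<close>, the binomial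
  theorem turns the alternating sum of \<open>prob_stirling\<close> into a coefficient of
  (\<open>egf a\<close> - 1)^k / k!. Summing over k gives the exponential.\<close>

lemma prob_bell_egf:
  fixes Ys :: "nat \<Rightarrow> 'a \<Rightarrow> real"
  assumes indep: "indep_vars (\<lambda>_. borel) Ys {1..}"
    and int: "\<And>j n. j \<ge> 1 \<Longrightarrow> integrable M (\<lambda>\<omega>. Ys j \<omega> ^ n)"
    and mom: "\<And>j n. j \<ge> 1 \<Longrightarrow> expectation (\<lambda>\<omega>. Ys j \<omega> ^ n) = a n"
  shows "egf (prob_bell M Ys) = fps_exp 1 oo (egf a - 1)"
proof (rule fps_ext)
  fix n
  have moment: "expectation (\<lambda>\<omega>. partial_sum Ys l \<omega> ^ m) = fact m * (egf a ^ l) $ m" for l m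
    using expectation_partial_sum_power_mult_prod[OF assms, of l m "\<lambda>_. 0"] by simp
  have "prob_stirling M Ys n k / fact n = ((egf a - 1) ^ k) $ n / fact k" for k
  proof -
    have "(egf a - 1) ^ k = (\<Sum>l\<le>k. of_nat (k choose l) * egf a ^ l * (- 1) ^ (k - l))"
      using binomial_ring[of "egf a" "- 1" k] by simp
    also have "\<dots> = (\<Sum>l\<le>k. fps_const (real (k choose l) * (- 1) ^ (k - l)) * egf a ^ l)"
    proof (intro sum.cong refl)
      fix l
      have "fps_const (real (k choose l) * (- 1) ^ (k - l)) = of_nat (k choose l) * (- 1) ^ (k - l)"
        by (cases "even (k - l)") (simp_all add: fps_of_nat[symmetric])
      then show "of_nat (k choose l) * egf a ^ l * (- 1) ^ (k - l) =
          fps_const (real (k choose l) * (- 1) ^ (k - l)) * egf a ^ l"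
        by (simp only: mult_ac)
    qed
    finally show ?thesis
      by (simp add: prob_stirling_def moment fps_sum_nth sum_distrib_left sum_divide_distrib
          atLeast0AtMost mult_ac)
  qed
  then show "egf (prob_bell M Ys) $ n = (fps_exp 1 oo (egf a - 1)) $ n"
    by (simp add: prob_bell_def fps_compose_nth sum_divide_distrib)
qed

end

theorem theorem2p5:
  fixes M :: "'a measure"
    and Y :: "'a \<Rightarrow> real"
    and Ys :: "nat \<Rightarrow> 'a \<Rightarrow> real"
    and \<delta> :: real
    and n l :: nat
  assumes "prob_space M"
    and "Y \<in> borel_measurable M"
    and "\<delta> > 0"
    and "\<And>t. \<bar>t\<bar> < \<delta> \<Longrightarrow> integrable M (\<lambda>\<omega>. exp (t * Y \<omega>))"
    and "prob_space.indep_vars M (\<lambda>_. borel) Ys {1..}"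
    and "\<And>j. j \<ge> 1 \<Longrightarrow> distr M borel (Ys j) = distr M borel Y"
  shows "prob_bell M Ys (l + n) =
    (\<Sum>k=0..n. \<Sum>m=0..l. real (l choose m) * (1 / fact k) *
      (\<Sum>ls\<in>compositions n k. multinomial n k ls *
        prob_space.expectation M
          (\<lambda>\<omega>. partial_sum Ys k \<omega> ^ (l - m) * (\<Prod>i=1..k. Ys i \<omega> ^ ls i))) *
      prob_bell M Ys m)"
proof -
  interpret prob_space M by fact
  have rv [measurable]: "Ys j \<in> borel_measurable M" if "j \<ge> 1" for j
    using assms(5) that by (auto simp: indep_vars_def)
  have intY: "integrable M (\<lambda>\<omega>. Y \<omega> ^ n)" for n
    by (rule integrable_power_of_mgf[OF assms(2-4)])
  define a where "a n = expectation (\<lambda>\<omega>. Y \<omega> ^ n)" for n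
  have int: "integrable M (\<lambda>\<omega>. Ys j \<omega> ^ n)" if "j \<ge> 1" for j n
    using intY[of n] integrable_distr_eq[OF rv[OF that], of "\<lambda>y. y ^ n"]
      integrable_distr_eq[OF assms(2), of "\<lambda>y. y ^ n"] assms(6)[OF that] by simp
  have mom: "expectation (\<lambda>\<omega>. Ys j \<omega> ^ n) = a n" if "j \<ge> 1" for j n
    using integral_distr[OF rv[OF that], of "\<lambda>y. y ^ n"]
      integral_distr[OF assms(2), of "\<lambda>y. y ^ n"] assms(6)[OF that] by (simp add: a_def)
  note moments = assms(5) int mom
  define F where "F j = egf (\<lambda>q. a (q + j))" for j
  define B where "B j = egf (\<lambda>q. prob_bell M Ys (q + j))" for j
  define G where "G = Abs_fps (\<lambda>j. if j = 0 then 0 else fps_const (1 / fact j) * F j)"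
  have a0: "a 0 = 1" by (simp add: a_def prob_space)
  have B0: "B 0 = fps_exp 1 oo (F 0 - 1)"
    using prob_bell_egf[OF moments] by (simp add: B_def F_def)
  \<comment> \<open>The chain rule for composition needs \<open>F 0 - 1\<close> to have constant
    term 0, which is \<open>a 0 = 1\<close>.\<close>
  have "fps_deriv (B 0) = B 0 * fps_deriv (F 0)"
    unfolding B0 using a0 by (subst fps_compose_deriv) (simp_all add: F_def)
  then have B1: "B 1 = B 0 * F 1"
    by (simp add: B_def F_def)
  have B_n: "B n = fps_const (fact n) * B 0 * (\<Sum>k=0..n. fps_const (1 / fact k) * (G ^ k) $ n)"
    unfolding G_def by (rule faa_di_bruno_exp[where B = B and F = F, OF _ _ B1]) (simp_all add: F_def B_def)
  \<comment> \<open>\<open>Z k\<close> is n! times the y^n coefficient of (f(x+y) - f(x))^k, as a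
    series in x.\<close>
  define Z where "Z k = (\<Sum>ls\<in>compositions n k. fps_const (multinomial n k ls) * (\<Prod>i=1..k. F (ls i)))" for k
  have G_pow: "fps_const (fact n) * (G ^ k) $ n = Z k" for k
  proof -
    have "(\<Prod>i=1..k. G $ ls i) = fps_const (1 / (\<Prod>i=1..k. fact (ls i))) * (\<Prod>i=1..k. F (ls i))"
      if "ls \<in> compositions n k" for ls
    proof -
      \<comment> \<open>Parts of a composition are positive, so the zero branch of \<open>G\<close>
        is never met.\<close>
      have "G $ ls i = fps_const (1 / fact (ls i)) * F (ls i)" if "i \<in> {1..k}" for i
        using \<open>ls \<in> compositions n k\<close> that by (force simp: G_def compositions_def PiE_iff)
      then have "(\<Prod>i=1..k. G $ ls i) = (\<Prod>i=1..k. fps_const (1 / fact (ls i)) * F (ls i))"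
        by (rule prod.cong[OF refl])
      also have "\<dots> = fps_const (\<Prod>i=1..k. 1 / fact (ls i)) * (\<Prod>i=1..k. F (ls i))"
        by (simp only: prod.distrib fps_const_prod)
      also have "(\<Prod>i=1..k. 1 / fact (ls i) :: real) = 1 / (\<Prod>i=1..k. fact (ls i))"
        by (simp add: prod_dividef)
      finally show ?thesis .
    qed
    moreover have "G $ 0 = 0" by (simp add: G_def)
    ultimately show ?thesis
      by (simp add: fps_power_nth_compositions Z_def sum_distrib_left multinomial_def mult.assoc[symmetric])
  qed
  define E where "E k ls p = expectation (\<lambda>\<omega>. partial_sum Ys k \<omega> ^ p * (\<Prod>i=1..k. Ys i \<omega> ^ ls i))" for k ls p
  have E: "E k ls p = fact p * (\<Prod>i=1..k. F (ls i)) $ p" for k ls p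
    unfolding E_def F_def by (rule expectation_partial_sum_power_mult_prod[OF moments])
  have "prob_bell M Ys (l + n) = fact l * B n $ l"
    by (simp add: B_def)
  also have "B n = (\<Sum>k=0..n. fps_const (1 / fact k) * (B 0 * Z k))"
    by (subst B_n) (simp only: G_pow[symmetric] sum_distrib_left mult_ac)
  also have "fact l * \<dots> $ l = (\<Sum>k=0..n. \<Sum>m=0..l. fact l * (1 / fact k) * (prob_bell M Ys m / fact m) *
      (\<Sum>ls\<in>compositions n k. multinomial n k ls * (\<Prod>i=1..k. F (ls i)) $ (l - m)))"
  proof -
    have "Z k $ p = (\<Sum>ls\<in>compositions n k. multinomial n k ls * (\<Prod>i=1..k. F (ls i)) $ p)" for k p
      by (simp add: Z_def fps_sum_nth)
    then show ?thesis
      by (simp add: fps_sum_nth fps_mult_nth[of "B 0"] sum_distrib_left mult.assoc)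
        (simp add: B_def mult_ac)
  qed
  \<comment> \<open>By \<open>E\<close>, each product coefficient is the expectation divided by
    (l-m)!; with l!/m! this makes the binomial coefficient.\<close>
  also have "\<dots> = (\<Sum>k=0..n. \<Sum>m=0..l. real (l choose m) * (1 / fact k) *
      (\<Sum>ls\<in>compositions n k. multinomial n k ls * E k ls (l - m)) * prob_bell M Ys m)"
    by (intro sum.cong refl)
      (simp add: E binomial_fact sum_distrib_left sum_distrib_right field_simps)
  finally show ?thesis unfolding E_def .
qed

end
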